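(* Let $\mathsf L\in\{\mathsf L_\Diamond,\mathsf L^\forall_\Diamond\}$, let $\mathcal A,\mathcal B$ be classes of pointed models, let $\mu:\mathsf L\to\mathbb N$ be any function (complexity measure), and let $m\in\mathbb N$. Then the following are equivalent: (1) Hercules has a winning strategy for the $(\mathsf L,\langle\mathcal A,\mathcal B\rangle)$ formula-complexity game on models with $\mu$ below $m$; (2) there is an $\mathsf L$-formula $\varphi$ with $\mu(\varphi)<m$ such that $\varphi$ is true in every pointed model of $\mathcal A$ and false in every pointed model of $\mathcal B$.
   Context: Fix a countably infinite set $P$ of propositional variables. $\mathsf L^\forall_\Diamond$ is the set of negation-normal-form formulas built from literals $p,\overline p$ ($p\in P$), $\bot,\top$ with $\vee,\wedge,\Diamond,\Box,\exists,\forall$ ($\exists,\forall$ the universal modalities); $\mathsf L_\Diamond$ is the fragment without $\exists,\forall$. A model is $(W,R,V)$ with $W\neq\emptyset$, $R\subseteq W\times W$, $V:W\to2^P$; a pointed model is $(\mathcal M,a)$ with $a\in W$; standard Kripke semantics. For a pointed model $\mathbf a=(\mathcal M,a)$ let $\Box\mathbf a=\{(\mathcal M,b):aRb\}$ and $\forall\mathbf a=\{(\mathcal M,b):b\in W\}$. For a class $\mathcal C$ of pointed models, $\mathcal C\models\varphi$ means every member satisfies $\varphi$. The $(\mathsf L,\langle\mathcal A,\mathcal B\rangle)$ game on models: players Hercules and the Hydra build a tree whose nodes $\eta$ are labelled by a pair $\langle\mathfrak L(\eta),\mathfrak R(\eta)\rangle$ of classes of pointed models and by a symbol. Initially there is a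 root labelled $\langle\mathcal A,\mathcal B\rangle$, declared a head. While heads remain, Hercules chooses a head $\eta$ and plays one of the following moves (only $\Diamond,\Box$, not $\exists,\forall$, if $\mathsf L=\mathsf L_\Diamond$): Literal: choose a literal $\iota$ with $\mathfrak L(\eta)\models\iota$ and $\mathfrak R(\eta)\models\neg\iota$; $\eta$ is labelled $\iota$ and becomes a stub (closed leaf). $\bot$: only if $\mathfrak L(\eta)=\emptyset$; labelled $\bot$, stub. $\top$: only if $\mathfrak R(\eta)=\emptyset$; labelled $\top$, stub. $\vee$: choose $\mathcal L_1\cup\mathcal L_2=\mathfrak L(\eta)$; add two heads as daughters labelled $\langle\mathcal L_1,\mathfrak R(\eta)\rangle,\langle\mathcal L_2,\mathfrak R(\eta)\rangle$. $\wedge$: choose $\mathcal R_1\cup\mathcal R_2=\mathfrak R(\eta)$; daughters $\langle\mathfrak L(\eta),\mathcal R_1\rangle,\langle\mathfrak L(\eta),\mathcal R_2\rangle$. $\Diamond$: for each $\mathbf l\in\mathfrak L(\eta)$ Hercules picks an element of $\Box\mathbf l$ (not allowed if some $\Box\mathbf l$ is empty), collected in $\mathcal L_1$; the Hydra picks, for each $\mathbf r\in\mathfrak R(\eta)$, a subset of $\Box\mathbf r$, the union being $\mathcal R_1$; one daughter head $\langle\mathcal L_1,\mathcal R_1\rangle$. $\Box$: dual: Hercules picks an element of $\Box\mathbf r$ for each $\mathbf r\in\mathfrak R(\eta)$ (not allowed if some is empty), the Hydra picks subsets of $\Box\mathbf l$ for $\mathbf l\in\mathfrak L(\eta)$. $\exists$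 and $\forall$: as $\Diamond$ and $\Box$ respectively, with $\forall\mathbf a$ in place of $\Box\mathbf a$. The node is labelled with the symbol of the move. The game ends when no heads remain (closed game tree $T$). $\psi_T$ is the formula whose syntax tree is $T$ (with its labels), and $\mu(T):=\mu(\psi_T)$. Hercules has a winning strategy with $\mu$ below $m$ if he has a strategy such that, however the Hydra plays, the game terminates in finitely many steps with a closed tree $T$ with $\mu(T)<m$. *)

theory Defs
  imports Main "HOL-Library.Countable_Set"
begin

section \<open>Formulas and models\<close>

datatype 'p literal = Pos 'p | Neg 'p

datatype 'p fm =
    FLit "'p literal"
  | FBot
  | FTop
  | FOr "'p fm" "'p fm"
  | FAnd "'p fm" "'p fm"
  | FDia "'p fm"
  | FBox "'p fm"
  | FEx "'p fm"
  | FAll "'p fm"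

primrec universal_free :: "'p fm \<Rightarrow> bool" where
  "universal_free (FLit i) = True"
| "universal_free FBot = True"
| "universal_free FTop = True"
| "universal_free (FOr \<phi> \<psi>) = (universal_free \<phi> \<and> universal_free \<psi>)"
| "universal_free (FAnd \<phi> \<psi>) = (universal_free \<phi> \<and> universal_free \<psi>)"
| "universal_free (FDia \<phi>) = universal_free \<phi>"
| "universal_free (FBox \<phi>) = universal_free \<phi>"
| "universal_free (FEx \<phi>) = False"
| "universal_free (FAll \<phi>) = False"

datatype lang = L_Dia | L_Dia_Forall

primrec formulas :: "lang \<Rightarrow> 'p fm set" where
  "formulas L_Dia = {\<phi>. universal_free \<phi>}"
| "formulas L_Dia_Forall = UNIV"

record ('w, 'p) model =
  worlds :: "'w set"
  rel :: "('w \<times> 'w) set"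
  val :: "'w \<Rightarrow> 'p set"  \<comment> \<open>only the values on \<open>worlds\<close> are relevant\<close>

type_synonym ('w, 'p) pmodel = "('w, 'p) model \<times> 'w"

definition pointed_models :: "('w, 'p) pmodel set" where
  "pointed_models =
    {(M, a). worlds M \<noteq> {} \<and> rel M \<subseteq> worlds M \<times> worlds M \<and> a \<in> worlds M}"

text \<open>The sets written \<open>\<box>\<a>\<close> and \<open>\<forall>\<a>\<close> for a pointed model \<open>\<a>\<close>.\<close>

fun succs :: "('w, 'p) pmodel \<Rightarrow> ('w, 'p) pmodel set" where
  "succs (M, a) = {(M, b) | b. (a, b) \<in> rel M}"

fun all_points :: "('w, 'p) pmodel \<Rightarrow> ('w, 'p) pmodel set" where
  "all_points (M, a) = {(M, b) | b. b \<in> worlds M}"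

fun sat_lit :: "('w, 'p) pmodel \<Rightarrow> 'p literal \<Rightarrow> bool" where
  "sat_lit (M, a) (Pos p) = (p \<in> val M a)"
| "sat_lit (M, a) (Neg p) = (p \<notin> val M a)"

primrec sat :: "'p fm \<Rightarrow> ('w, 'p) pmodel \<Rightarrow> bool" where
  "sat (FLit i) x = sat_lit x i"
| "sat FBot x = False"
| "sat FTop x = True"
| "sat (FOr \<phi> \<psi>) x = (sat \<phi> x \<or> sat \<psi> x)"
| "sat (FAnd \<phi> \<psi>) x = (sat \<phi> x \<and> sat \<psi> x)"
| "sat (FDia \<phi>) x = (\<exists>y\<in>succs x. sat \<phi> y)"
| "sat (FBox \<phi>) x = (\<forall>y\<in>succs x. sat \<phi> y)"
| "sat (FEx \<phi>) x = (\<exists>y\<in>all_points x. sat \<phi> y)"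
| "sat (FAll \<phi>) x = (\<forall>y\<in>all_points x. sat \<phi> y)"


section \<open>Game trees\<close>

datatype 'p leaf_symbol = SLit "'p literal" | SBot | STop
datatype un_symbol = SDia | SBox | SEx | SAll
datatype bin_symbol = SOr | SAnd

text \<open>Every node carries its pair of classes; every node that is not a head also carries
  its symbol. Stubs are the leaves that are not heads.\<close>

datatype ('w, 'p) gtree =
    Head "('w, 'p) pmodel set" "('w, 'p) pmodel set"
  | Stub "('w, 'p) pmodel set" "('w, 'p) pmodel set" "'p leaf_symbol"
  | Unary "('w, 'p) pmodel set" "('w, 'p) pmodel set" un_symbol "('w, 'p) gtree"
  | Binary "('w, 'p) pmodel set" "('w, 'p) pmodel set" bin_symbol "('w, 'p) gtree" "('w, 'p) gtree"

text \<open>Nodes are addressed by the path leading to them from the root, \<open>0\<close> being the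
  only or the first daughter and \<open>1\<close> the second one.\<close>

type_synonym address = "nat list"

primrec heads ::
  "('w, 'p) gtree \<Rightarrow> (address \<times> ('w, 'p) pmodel set \<times> ('w, 'p) pmodel set) set" where
  "heads (Head X Y) = {([], X, Y)}"
| "heads (Stub X Y s) = {}"
| "heads (Unary X Y s T) = {(0 # p, Z) | p Z. (p, Z) \<in> heads T}"
| "heads (Binary X Y s T U) =
    {(0 # p, Z) | p Z. (p, Z) \<in> heads T} \<union> {(1 # p, Z) | p Z. (p, Z) \<in> heads U}"

definition closed_tree :: "('w, 'p) gtree \<Rightarrow> bool" where
  "closed_tree T \<longleftrightarrow> heads T = {}"

text \<open>\<open>replace_head T p S\<close> is \<open>T\<close> with the head at address \<open>p\<close> replaced by \<open>S\<close>
  (and \<open>T\<close> itself if there is no head at \<open>p\<close>).\<close>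

primrec replace_head ::
  "('w, 'p) gtree \<Rightarrow> address \<Rightarrow> ('w, 'p) gtree \<Rightarrow> ('w, 'p) gtree" where
  "replace_head (Head X Y) p S = (if p = [] then S else Head X Y)"
| "replace_head (Stub X Y s) p S = Stub X Y s"
| "replace_head (Unary X Y s T) p S =
    (case p of
      [] \<Rightarrow> Unary X Y s T
    | i # q \<Rightarrow> if i = 0 then Unary X Y s (replace_head T q S) else Unary X Y s T)"
| "replace_head (Binary X Y s T U) p S =
    (case p of
      [] \<Rightarrow> Binary X Y s T U
    | i # q \<Rightarrow>
        if i = 0 then Binary X Y s (replace_head T q S) U
        else if i = 1 then Binary X Y s T (replace_head U q S)
        else Binary X Y s T U)"

primrec leaf_fm :: "'p leaf_symbol \<Rightarrow> 'p fm" where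
  "leaf_fm (SLit i) = FLit i"
| "leaf_fm SBot = FBot"
| "leaf_fm STop = FTop"

primrec un_fm :: "un_symbol \<Rightarrow> 'p fm \<Rightarrow> 'p fm" where
  "un_fm SDia = FDia"
| "un_fm SBox = FBox"
| "un_fm SEx = FEx"
| "un_fm SAll = FAll"

primrec bin_fm :: "bin_symbol \<Rightarrow> 'p fm \<Rightarrow> 'p fm \<Rightarrow> 'p fm" where
  "bin_fm SOr = FOr"
| "bin_fm SAnd = FAnd"

text \<open>The formula \<open>\<psi>\<^sub>T\<close> whose syntax tree is \<open>T\<close>; meaningful for closed trees only.\<close>

primrec tree_fm :: "('w, 'p) gtree \<Rightarrow> 'p fm" where
  "tree_fm (Head X Y) = undefined"
| "tree_fm (Stub X Y s) = leaf_fm s"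
| "tree_fm (Unary X Y s T) = un_fm s (tree_fm T)"
| "tree_fm (Binary X Y s T U) = bin_fm s (tree_fm T) (tree_fm U)"


section \<open>Moves\<close>

text \<open>In the modal moves Hercules' picks are given by a function choosing an element for
  each pointed model of the left class (\<open>\<diamond>\<close>, \<open>\<exists>\<close>) or the right class (\<open>\<box>\<close>, \<open>\<forall>\<close>).\<close>

datatype ('w, 'p) hmove =
    MLit "'p literal"
  | MBot
  | MTop
  | MOr "('w, 'p) pmodel set" "('w, 'p) pmodel set"
  | MAnd "('w, 'p) pmodel set" "('w, 'p) pmodel set"
  | MDia "('w, 'p) pmodel \<Rightarrow> ('w, 'p) pmodel"
  | MBox "('w, 'p) pmodel \<Rightarrow> ('w, 'p) pmodel"
  | MEx "('w, 'p) pmodel \<Rightarrow> ('w, 'p) pmodel"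
  | MAll "('w, 'p) pmodel \<Rightarrow> ('w, 'p) pmodel"

primrec allowed ::
  "lang \<Rightarrow> ('w, 'p) pmodel set \<Rightarrow> ('w, 'p) pmodel set \<Rightarrow> ('w, 'p) hmove \<Rightarrow> bool" where
  "allowed L X Y (MLit i) = ((\<forall>l\<in>X. sat (FLit i) l) \<and> (\<forall>r\<in>Y. \<not> sat (FLit i) r))"
| "allowed L X Y MBot = (X = {})"
| "allowed L X Y MTop = (Y = {})"
| "allowed L X Y (MOr X1 X2) = (X1 \<union> X2 = X)"
| "allowed L X Y (MAnd Y1 Y2) = (Y1 \<union> Y2 = Y)"
| "allowed L X Y (MDia g) = (\<forall>l\<in>X. g l \<in> succs l)"
| "allowed L X Y (MBox g) = (\<forall>r\<in>Y. g r \<in> succs r)"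
| "allowed L X Y (MEx g) = (L = L_Dia_Forall \<and> (\<forall>l\<in>X. g l \<in> all_points l))"
| "allowed L X Y (MAll g) = (L = L_Dia_Forall \<and> (\<forall>r\<in>Y. g r \<in> all_points r))"

text \<open>The Hydra replies to modal moves only, by choosing a subset for each pointed model
  of the class on the opposite side.\<close>

type_synonym ('w, 'p) reply = "(('w, 'p) pmodel \<Rightarrow> ('w, 'p) pmodel set) option"

text \<open>\<open>turn X Y mv \<rho> S\<close>: after Hercules has played \<open>mv\<close> on a head labelled \<open>\<langle>X, Y\<rangle>\<close>,
  \<open>\<rho>\<close> is a legal reply of the Hydra, and the head is then replaced by \<open>S\<close>.\<close>

inductive turn ::
  "('w, 'p) pmodel set \<Rightarrow> ('w, 'p) pmodel set \<Rightarrow> ('w, 'p) hmove \<Rightarrow> ('w, 'p) reply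
    \<Rightarrow> ('w, 'p) gtree \<Rightarrow> bool"
  for X Y where
  lit: "turn X Y (MLit i) None (Stub X Y (SLit i))"
| bot: "turn X Y MBot None (Stub X Y SBot)"
| top: "turn X Y MTop None (Stub X Y STop)"
| disj: "turn X Y (MOr X1 X2) None (Binary X Y SOr (Head X1 Y) (Head X2 Y))"
| conj: "turn X Y (MAnd Y1 Y2) None (Binary X Y SAnd (Head X Y1) (Head X Y2))"
| dia: "\<forall>r\<in>Y. f r \<subseteq> succs r \<Longrightarrow>
    turn X Y (MDia g) (Some f) (Unary X Y SDia (Head (g ` X) (\<Union>r\<in>Y. f r)))"
| box: "\<forall>l\<in>X. f l \<subseteq> succs l \<Longrightarrow>
    turn X Y (MBox g) (Some f) (Unary X Y SBox (Head (\<Union>l\<in>X. f l) (g ` Y)))"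
| ex: "\<forall>r\<in>Y. f r \<subseteq> all_points r \<Longrightarrow>
    turn X Y (MEx g) (Some f) (Unary X Y SEx (Head (g ` X) (\<Union>r\<in>Y. f r)))"
| all: "\<forall>l\<in>X. f l \<subseteq> all_points l \<Longrightarrow>
    turn X Y (MAll g) (Some f) (Unary X Y SAll (Head (\<Union>l\<in>X. f l) (g ` Y)))"


section \<open>Plays and strategies\<close>

text \<open>A history lists the rounds played so far, oldest first. A strategy for Hercules may
  depend on the whole history and yields the head to play on and the move to play there.\<close>

type_synonym ('w, 'p) history = "(address \<times> ('w, 'p) hmove \<times> ('w, 'p) reply) list"
type_synonym ('w, 'p) strategy = "('w, 'p) history \<Rightarrow> address \<times> ('w, 'p) hmove"

text \<open>\<open>play L A B \<sigma> h T\<close>: \<open>h\<close> is the history of a legal partial play of the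
  game on \<open>\<langle>A, B\<rangle>\<close> in which Hercules follows \<open>\<sigma>\<close>, and \<open>T\<close> is the tree built by it.\<close>

inductive play ::
  "lang \<Rightarrow> ('w, 'p) pmodel set \<Rightarrow> ('w, 'p) pmodel set \<Rightarrow> ('w, 'p) strategy
    \<Rightarrow> ('w, 'p) history \<Rightarrow> ('w, 'p) gtree \<Rightarrow> bool"
  for L A B \<sigma> where
  start: "play L A B \<sigma> [] (Head A B)"
| round: "\<lbrakk>play L A B \<sigma> h T; \<sigma> h = (p, mv); (p, X, Y) \<in> heads T; allowed L X Y mv;
    turn X Y mv \<rho> S\<rbrakk> \<Longrightarrow> play L A B \<sigma> (h @ [(p, mv, \<rho>)]) (replace_head T p S)"

text \<open>Against every behaviour of the Hydra: Hercules never gets stuck while heads remain,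
  the game does not go on forever, and a final tree has complexity below \<open>m\<close>.\<close>

definition winning_strategy ::
  "lang \<Rightarrow> ('w, 'p) pmodel set \<Rightarrow> ('w, 'p) pmodel set \<Rightarrow> ('p fm \<Rightarrow> nat) \<Rightarrow> nat
    \<Rightarrow> ('w, 'p) strategy \<Rightarrow> bool" where
  "winning_strategy L A B \<mu> m \<sigma> \<longleftrightarrow>
    (\<forall>h T. play L A B \<sigma> h T \<longrightarrow> \<not> closed_tree T \<longrightarrow>
      (\<exists>p mv X Y. \<sigma> h = (p, mv) \<and> (p, X, Y) \<in> heads T \<and> allowed L X Y mv)) \<and>
    \<not> (\<exists>rs. \<forall>n. \<exists>T. play L A B \<sigma> (map rs [0..<n]) T) \<and>
    (\<forall>h T. play L A B \<sigma> h T \<longrightarrow> closed_tree T \<longrightarrow> \<mu> (tree_fm T) < m)"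

end

theory Submission
  imports Defs
begin

text \<open>
  Say that a formula completes a game tree if it arises from the tree by filling every head with
  a formula separating the two classes of that head; a closed tree is completed by its own formula
  only. Hercules wins by keeping the separating formula \<open>\<phi>\<close> a completion of the tree: every round
  adds a node that is not a head, and \<open>\<phi>\<close> bounds their number. Conversely, if the Hydra replies to
  each modal move with all available points, then a round creates no new completions. So the
  formula of the final closed tree completes the initial head, i.e. it separates the two classes.
\<close>

section \<open>Separating formulas and completions of game trees\<close>

definition separates ::
  "lang \<Rightarrow> ('w, 'p) pmodel set \<Rightarrow> ('w, 'p) pmodel set \<Rightarrow> 'p fm \<Rightarrow> bool" where
  "separates L X Y \<phi> \<longleftrightarrow> \<phi> \<in> formulas L \<and> (\<forall>x\<in>X. sat \<phi> x) \<and> (\<forall>y\<in>Y. \<not> sat \<phi> y)"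

text \<open>The classes at labelled nodes are ignored: only heads impose a semantic condition, so a
  round affects the requirement at the head played on and nowhere else.\<close>

primrec completes :: "lang \<Rightarrow> ('w, 'p) gtree \<Rightarrow> 'p fm \<Rightarrow> bool" where
  "completes L (Head X Y) \<phi> \<longleftrightarrow> separates L X Y \<phi>"
| "completes L (Stub X Y s) \<phi> \<longleftrightarrow> \<phi> = leaf_fm s"
| "completes L (Unary X Y s T) \<phi> \<longleftrightarrow> (\<exists>\<psi>. \<phi> = un_fm s \<psi> \<and> completes L T \<psi>)"
| "completes L (Binary X Y s T U) \<phi> \<longleftrightarrow>
    (\<exists>\<psi> \<chi>. \<phi> = bin_fm s \<psi> \<chi> \<and> completes L T \<psi> \<and> completes L U \<chi>)"

primrec labelled_nodes :: "('w, 'p) gtree \<Rightarrow> nat" where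
  "labelled_nodes (Head X Y) = 0"
| "labelled_nodes (Stub X Y s) = 1"
| "labelled_nodes (Unary X Y s T) = Suc (labelled_nodes T)"
| "labelled_nodes (Binary X Y s T U) = Suc (labelled_nodes T + labelled_nodes U)"

lemma closed_tree_simps [simp]:
  "\<not> closed_tree (Head X Y)"
  "closed_tree (Stub X Y s)"
  "closed_tree (Unary X Y u T) \<longleftrightarrow> closed_tree T"
  "closed_tree (Binary X Y b T U) \<longleftrightarrow> closed_tree T \<and> closed_tree U"
  by (auto simp: closed_tree_def)

lemma completes_closed_iff:
  "closed_tree T \<Longrightarrow> completes L T \<phi> \<longleftrightarrow> \<phi> = tree_fm T"
  by (induction T arbitrary: \<phi>) auto

text \<open>The factor 2 makes up for the leaves, which \<open>size\<close> counts as 0.\<close>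

lemma labelled_nodes_le_size:
  "completes L T \<phi> \<Longrightarrow> labelled_nodes T \<le> 2 * size \<phi> + 1"
proof (induction T arbitrary: \<phi>)
  case (Unary X Y s T)
  then obtain \<psi> where "\<phi> = un_fm s \<psi>" "completes L T \<psi>" by auto
  with Unary.IH[of \<psi>] show ?case by (cases s) auto
next
  case (Binary X Y s T U)
  then obtain \<psi> \<chi> where "\<phi> = bin_fm s \<psi> \<chi>" "completes L T \<psi>" "completes L U \<chi>" by auto
  with Binary.IH(1)[of \<psi>] Binary.IH(2)[of \<chi>] show ?case by (cases s) auto
qed auto

lemma heads_unique:
  "(p, Z) \<in> heads T \<Longrightarrow> (p, Z') \<in> heads T \<Longrightarrow> Z = Z'"
  by (induction T arbitrary: p) auto

lemma turn_unique:
  "turn X Y mv \<rho> S \<Longrightarrow> turn X Y mv \<rho> S' \<Longrightarrow> S = S'"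
  by (auto elim!: turn.cases)

lemma labelled_nodes_turn:
  "turn X Y mv \<rho> S \<Longrightarrow> labelled_nodes S = 1"
  by (auto elim!: turn.cases)

lemma labelled_nodes_replace_head:
  "(p, Z) \<in> heads T \<Longrightarrow>
    labelled_nodes (replace_head T p S) = labelled_nodes T + labelled_nodes S"
  by (induction T arbitrary: p) auto

text \<open>Each round trades a head, which does not count, for one labelled node with its daughter
  heads. A bound on labelled nodes thus bounds the length of a play.\<close>

lemma labelled_nodes_play:
  "play L A B \<sigma> h T \<Longrightarrow> labelled_nodes T = length h"
  by (induction rule: play.induct)
    (auto simp: labelled_nodes_replace_head dest: labelled_nodes_turn)

text \<open>\<open>\<psi>\<close> is the subformula of \<open>\<phi>\<close> at address
  \<open>p\<close>. It is fixed before \<open>S\<close>, so Hercules can read his move off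
  \<open>\<psi>\<close> without knowing the reply.\<close>

lemma completes_replace_headI:
  "completes L T \<phi> \<Longrightarrow> (p, X, Y) \<in> heads T \<Longrightarrow>
    \<exists>\<psi>. separates L X Y \<psi> \<and> (\<forall>S. completes L S \<psi> \<longrightarrow> completes L (replace_head T p S) \<phi>)"
proof (induction T arbitrary: \<phi> p)
  case (Unary X' Y' s T)
  then obtain q \<phi>1 where "p = 0 # q" "(q, X, Y) \<in> heads T" "\<phi> = un_fm s \<phi>1" "completes L T \<phi>1"
    by auto
  with Unary.IH show ?case by fastforce
next
  case (Binary X' Y' s T U)
  then obtain \<phi>1 \<phi>2 where \<phi>: "\<phi> = bin_fm s \<phi>1 \<phi>2" "completes L T \<phi>1" "completes L U \<phi>2"
    by auto
  from Binary.prems(2) consider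
    q where "p = 0 # q" "(q, X, Y) \<in> heads T" | q where "p = 1 # q" "(q, X, Y) \<in> heads U"
    by auto
  then show ?case
  proof cases
    case 1
    with \<phi> Binary.IH(1)[of \<phi>1 q] show ?thesis by fastforce
  next
    case 2
    with \<phi> Binary.IH(2)[of \<phi>2 q] show ?thesis by fastforce
  qed
qed auto

text \<open>A completion of the new tree has a completion of \<open>S\<close> at address
  \<open>p\<close>; by assumption this separates \<open>X\<close> and \<open>Y\<close>, so it may
  fill the old head as well.\<close>

lemma completes_replace_headD:
  assumes "\<And>\<psi>. completes L S \<psi> \<Longrightarrow> separates L X Y \<psi>"
  shows "(p, X, Y) \<in> heads T \<Longrightarrow> completes L (replace_head T p S) \<phi> \<Longrightarrow> completes L T \<phi>"
  by (induction T arbitrary: \<phi> p) (use assms in fastforce)+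

section \<open>One round, from either player's side\<close>

text \<open>The main connective of \<open>\<psi>\<close> dictates the move. For
  \<open>FDia \<psi>1\<close>, Hercules picks successors satisfying \<open>\<psi>1\<close>; as
  \<open>\<psi>1\<close> fails at all successors of points of \<open>Y\<close>, it separates the new
  classes whatever subsets the Hydra takes. The other modal cases are analogous.\<close>

lemma separating_move:
  assumes "separates L X Y \<psi>"
  shows "\<exists>mv. allowed L X Y mv \<and> (\<forall>\<rho> S. turn X Y mv \<rho> S \<longrightarrow> completes L S \<psi>)"
proof (cases \<psi>)
  case (FLit i)
  with assms show ?thesis
    by (intro exI[of _ "MLit i"]) (auto simp: separates_def elim!: turn.cases)
next
  case FBot
  with assms show ?thesis
    by (intro exI[of _ MBot]) (auto simp: separates_def elim!: turn.cases)
next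
  case FTop
  with assms show ?thesis
    by (intro exI[of _ MTop]) (auto simp: separates_def elim!: turn.cases)
next
  case (FOr \<psi>1 \<psi>2)
  \<comment> \<open>Points satisfying both disjuncts go to both daughters. The split on
    \<open>L\<close> shows that the disjuncts stay in the language.\<close>
  with assms show ?thesis
    by (intro exI[of _ "MOr {x\<in>X. sat \<psi>1 x} {x\<in>X. sat \<psi>2 x}"])
      (cases L; auto simp: separates_def elim!: turn.cases)
next
  case (FAnd \<psi>1 \<psi>2)
  with assms show ?thesis
    by (intro exI[of _ "MAnd {y\<in>Y. \<not> sat \<psi>1 y} {y\<in>Y. \<not> sat \<psi>2 y}"])
      (cases L; auto simp: separates_def elim!: turn.cases)
next
  case (FDia \<psi>1)
  with assms have "\<forall>x\<in>X. \<exists>y\<in>succs x. sat \<psi>1 y" by (simp add: separates_def)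
  then obtain g where "\<forall>x\<in>X. g x \<in> succs x \<and> sat \<psi>1 (g x)" by metis
  with assms FDia show ?thesis
    by (intro exI[of _ "MDia g"]) (cases L; fastforce simp: separates_def elim!: turn.cases)
next
  case (FBox \<psi>1)
  with assms have "\<forall>x\<in>Y. \<exists>y\<in>succs x. \<not> sat \<psi>1 y" by (simp add: separates_def)
  then obtain g where "\<forall>x\<in>Y. g x \<in> succs x \<and> \<not> sat \<psi>1 (g x)" by metis
  with assms FBox show ?thesis
    by (intro exI[of _ "MBox g"]) (cases L; fastforce simp: separates_def elim!: turn.cases)
next
  case (FEx \<psi>1)
  with assms have "\<forall>x\<in>X. \<exists>y\<in>all_points x. sat \<psi>1 y" by (simp add: separates_def)
  then obtain g where "\<forall>x\<in>X. g x \<in> all_points x \<and> sat \<psi>1 (g x)" by metis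
  \<comment> \<open>For \<open>L_Dia\<close> the case is contradictory, as
    \<open>FEx \<psi>1\<close> is not universal-free; this is what makes the move legal.\<close>
  with assms FEx show ?thesis
    by (intro exI[of _ "MEx g"]) (cases L; fastforce simp: separates_def elim!: turn.cases)
next
  case (FAll \<psi>1)
  with assms have "\<forall>x\<in>Y. \<exists>y\<in>all_points x. \<not> sat \<psi>1 y" by (simp add: separates_def)
  then obtain g where "\<forall>x\<in>Y. g x \<in> all_points x \<and> \<not> sat \<psi>1 (g x)" by metis
  with assms FAll show ?thesis
    by (intro exI[of _ "MAll g"]) (cases L; fastforce simp: separates_def elim!: turn.cases)
qed

text \<open>If the Hydra takes every available point, a formula failing on all of them makes the
  diamond (or \<open>FEx\<close>) formula false on \<open>Y\<close>, while the picks of Hercules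
  witness it on \<open>X\<close>; dually for \<open>MBox\<close> and \<open>MAll\<close>. In the
  other cases legality of the move gives separation.\<close>

lemma greedy_reply:
  assumes "allowed L X Y mv"
  shows "\<exists>\<rho> S. turn X Y mv \<rho> S \<and> (\<forall>\<psi>. completes L S \<psi> \<longrightarrow> separates L X Y \<psi>)"
proof (cases mv)
  case (MLit i)
  with assms show ?thesis by (cases L) (auto simp: separates_def intro!: exI turn.lit)
next
  case MBot
  with assms show ?thesis by (cases L) (auto simp: separates_def intro!: exI turn.bot)
next
  case MTop
  with assms show ?thesis by (cases L) (auto simp: separates_def intro!: exI turn.top)
next
  case (MOr X1 X2)
  with assms show ?thesis by (cases L) (auto simp: separates_def intro!: exI turn.disj)
next
  case (MAnd Y1 Y2)
  with assms show ?thesis by (cases L) (auto simp: separates_def intro!: exI turn.conj)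
next
  case (MDia g)
  let ?S = "Unary X Y SDia (Head (g ` X) (\<Union>r\<in>Y. succs r))"
  have "turn X Y (MDia g) (Some succs) ?S" by (rule turn.dia) simp
  moreover have "separates L X Y \<psi>" if "completes L ?S \<psi>" for \<psi>
    using that assms MDia by (cases L; fastforce simp: separates_def)
  ultimately show ?thesis using MDia by blast
next
  case (MBox g)
  let ?S = "Unary X Y SBox (Head (\<Union>l\<in>X. succs l) (g ` Y))"
  have "turn X Y (MBox g) (Some succs) ?S" by (rule turn.box) simp
  moreover have "separates L X Y \<psi>" if "completes L ?S \<psi>" for \<psi>
    using that assms MBox by (cases L; fastforce simp: separates_def)
  ultimately show ?thesis using MBox by blast
next
  case (MEx g)
  let ?S = "Unary X Y SEx (Head (g ` X) (\<Union>r\<in>Y. all_points r))"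
  have "turn X Y (MEx g) (Some all_points) ?S" by (rule turn.ex) simp
  moreover have "separates L X Y \<psi>" if "completes L ?S \<psi>" for \<psi>
    using that assms MEx by (cases L; fastforce simp: separates_def)
  ultimately show ?thesis using MEx by blast
next
  case (MAll g)
  let ?S = "Unary X Y SAll (Head (\<Union>l\<in>X. all_points l) (g ` Y))"
  have "turn X Y (MAll g) (Some all_points) ?S" by (rule turn.all) simp
  moreover have "separates L X Y \<psi>" if "completes L ?S \<psi>" for \<psi>
    using that assms MAll by (cases L; fastforce simp: separates_def)
  ultimately show ?thesis using MAll by blast
qed

section \<open>From a separating formula to a winning strategy\<close>

text \<open>A history records address, move and reply of every round, and these determine the tree,
  whichever strategy produced them.\<close>

lemma play_unique:
  "play L A B \<sigma> h T \<Longrightarrow> play L A B \<sigma>' h T' \<Longrightarrow> T = T'"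
proof (induction arbitrary: T' rule: play.induct)
  case start
  then show ?case by (auto elim: play.cases)
next
  case (round h T p mv X Y \<rho> S)
  from round.prems obtain T1 X1 Y1 S1 where *: "play L A B \<sigma>' h T1" "(p, X1, Y1) \<in> heads T1"
    "turn X1 Y1 mv \<rho> S1" "T' = replace_head T1 p S1"
    by (auto elim: play.cases)
  with round.IH have "T1 = T" by simp
  with * round.hyps have "X1 = X \<and> Y1 = Y" by (auto dest: heads_unique)
  with * round.hyps \<open>T1 = T\<close> show ?case by (auto dest: turn_unique)
qed

lemma winning_strategy_if_separates:
  fixes A B :: "('w, 'p) pmodel set"
  assumes sep: "separates L A B \<phi>" and "\<mu> \<phi> < m"
  shows "\<exists>\<sigma>. winning_strategy L A B \<mu> m \<sigma>"
proof -
  define safe where "safe T = (\<lambda>(p, mv). \<exists>X Y. (p, X, Y) \<in> heads T \<and> allowed L X Y mv \<and>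
    (\<forall>\<rho> S. turn X Y mv \<rho> S \<longrightarrow> completes L (replace_head T p S) \<phi>))" for T :: "('w, 'p) gtree"
  \<comment> \<open>Strategies see only the history, so the tree is recovered from it. Quantifying
    over all strategies avoids circularity, since \<open>\<sigma>\<close> is defined from
    \<open>tree\<close>.\<close>
  define tree where "tree h = (THE T. \<exists>\<sigma>. play L A B \<sigma> h T)" for h
  \<comment> \<open>The value is arbitrary if no safe choice exists; along plays following
    \<open>\<sigma>\<close> this happens only at closed trees.\<close>
  define \<sigma> where "\<sigma> h = (SOME z. safe (tree h) z)" for h
  have tree: "tree h = T" if "play L A B \<sigma> h T" for h T
    unfolding tree_def using that play_unique by blast
  have safe: "\<exists>z. safe T z" if "completes L T \<phi>" "\<not> closed_tree T" for T
  proof -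
    from that(2) obtain p X Y where head: "(p, X, Y) \<in> heads T"
      by (auto simp: closed_tree_def)
    with completes_replace_headI[OF that(1)] obtain \<psi> where \<psi>: "separates L X Y \<psi>"
      "\<forall>S. completes L S \<psi> \<longrightarrow> completes L (replace_head T p S) \<phi>" by blast
    with separating_move[OF \<psi>(1)] head show ?thesis
      unfolding safe_def by blast
  qed
  have \<sigma>: "safe T (\<sigma> h)" if "play L A B \<sigma> h T" "completes L T \<phi>" "\<not> closed_tree T" for h T
    unfolding \<sigma>_def tree[OF that(1)] using safe[OF that(2,3)] by (rule someI_ex)
  have completes: "completes L T \<phi>" if "play L A B \<sigma> h T" for h T
    using that
  proof (induction rule: play.induct)
    case start
    then show ?case using sep by simp
  next
    case (round h T p mv X Y \<rho> S)
    \<comment> \<open>The head at \<open>p\<close> shows that \<open>T\<close> is not closed, so the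
      choice of \<open>\<sigma>\<close> is safe.\<close>
    then have "safe T (p, mv)" using \<sigma>[of h T] by (auto simp: closed_tree_def)
    then obtain X' Y' where "(p, X', Y') \<in> heads T"
      "\<forall>\<rho> S. turn X' Y' mv \<rho> S \<longrightarrow> completes L (replace_head T p S) \<phi>"
      unfolding safe_def by auto
    with round.hyps heads_unique show ?case by blast
  qed
  have "winning_strategy L A B \<mu> m \<sigma>"
    unfolding winning_strategy_def
  proof (intro conjI allI impI notI)
    fix h T assume "play L A B \<sigma> h T" "\<not> closed_tree T"
    with \<sigma> completes have "safe T (\<sigma> h)" by blast
    then show "\<exists>p mv X Y. \<sigma> h = (p, mv) \<and> (p, X, Y) \<in> heads T \<and> allowed L X Y mv"
      unfolding safe_def by (cases "\<sigma> h") auto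
  next
    assume "\<exists>rs. \<forall>n. \<exists>T. play L A B \<sigma> (map rs [0..<n]) T"
    \<comment> \<open>This length exceeds by one the largest number of labelled nodes in a tree
      completed by \<open>\<phi>\<close>.\<close>
    then obtain rs T where "play L A B \<sigma> (map rs [0..<2 * size \<phi> + 2]) T" by blast
    from labelled_nodes_play[OF this] labelled_nodes_le_size[OF completes[OF this]]
    show False by simp
  next
    fix h T assume "play L A B \<sigma> h T" "closed_tree T"
    with completes completes_closed_iff \<open>\<mu> \<phi> < m\<close> show "\<mu> (tree_fm T) < m" by metis
  qed
  then show ?thesis by blast
qed

section \<open>From a winning strategy to a separating formula\<close>

text \<open>Without a suitable formula, the play against the greedy Hydra could never close and
  would go on forever, which a winning strategy excludes.\<close>

lemma separates_if_winning_strategy: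
  fixes A B :: "('w, 'p) pmodel set"
  assumes win: "winning_strategy L A B \<mu> m \<sigma>"
  shows "\<exists>\<phi>. separates L A B \<phi> \<and> \<mu> \<phi> < m"
proof (rule ccontr)
  assume contra: "\<not> ?thesis"
  define good where "good h \<longleftrightarrow>
    (\<exists>T. play L A B \<sigma> h T \<and> (\<forall>\<phi>. completes L T \<phi> \<longrightarrow> separates L A B \<phi>))" for h
  have "good []"
    unfolding good_def by (auto intro!: exI play.start)
  have extend: "\<exists>h'. good h' \<and> (\<exists>z. h' = h @ [z])" if "good h" for h
  proof -
    from that obtain T where T: "play L A B \<sigma> h T"
      "\<forall>\<phi>. completes L T \<phi> \<longrightarrow> separates L A B \<phi>" unfolding good_def by blast
    \<comment> \<open>Otherwise \<open>tree_fm T\<close> would separate \<open>A\<close> and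
      \<open>B\<close>, with \<open>\<mu>\<close> below \<open>m\<close> because
      \<open>\<sigma>\<close> wins.\<close>
    have "\<not> closed_tree T"
      using T contra win completes_closed_iff unfolding winning_strategy_def by blast
    with win T(1) obtain p mv X Y where mv: "\<sigma> h = (p, mv)" "(p, X, Y) \<in> heads T"
      "allowed L X Y mv" unfolding winning_strategy_def by blast
    from greedy_reply[OF mv(3)] obtain \<rho> S where S: "turn X Y mv \<rho> S"
      "\<And>\<psi>. completes L S \<psi> \<Longrightarrow> separates L X Y \<psi>" by blast
    have "play L A B \<sigma> (h @ [(p, mv, \<rho>)]) (replace_head T p S)"
      by (rule play.round[OF T(1) mv S(1)])
    moreover have "separates L A B \<phi>" if "completes L (replace_head T p S) \<phi>" for \<phi>
      using completes_replace_headD[OF S(2) mv(2) that] T(2) by blast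
    ultimately show ?thesis unfolding good_def by blast
  qed
  \<comment> \<open>Dependent choice yields histories each extending the previous one by a round;
    their last entries form the infinite play \<open>rs\<close>.\<close>
  have "\<exists>hs. \<forall>n. (good (hs n) \<and> (n = 0 \<longrightarrow> hs n = [])) \<and> (\<exists>z. hs (Suc n) = hs n @ [z])"
    by (rule dependent_nat_choice) (use \<open>good []\<close> extend in auto)
  then obtain hs where hs: "\<And>n. good (hs n)" "hs 0 = []" "\<And>n. \<exists>z. hs (Suc n) = hs n @ [z]"
    by blast
  then obtain rs where rs: "\<And>n. hs (Suc n) = hs n @ [rs n]" by metis
  have "hs n = map rs [0..<n]" for n
    by (induction n) (simp_all add: hs(2) rs)
  with hs(1) have "\<forall>n. \<exists>T. play L A B \<sigma> (map rs [0..<n]) T"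
    unfolding good_def by metis
  with win show False unfolding winning_strategy_def by blast
qed

theorem theorem3p3:
  fixes L :: lang
    and A B :: "('w, 'p) pmodel set"
    and \<mu> :: "'p fm \<Rightarrow> nat"
    and m :: nat
  assumes "countable (UNIV :: 'p set)" and "infinite (UNIV :: 'p set)"
    and "A \<subseteq> pointed_models" and "B \<subseteq> pointed_models"
  shows "(\<exists>\<sigma>. winning_strategy L A B \<mu> m \<sigma>) \<longleftrightarrow>
    (\<exists>\<phi>\<in>formulas L. \<mu> \<phi> < m \<and> (\<forall>a\<in>A. sat \<phi> a) \<and> (\<forall>b\<in>B. \<not> sat \<phi> b))"
  using winning_strategy_if_separates[of L A B _ \<mu> m]
    separates_if_winning_strategy[of L A B \<mu> m]
  unfolding separates_def by blast

end
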